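(* Let $G$ be a totally disconnected locally compact group, $\alpha\in\mathrm{End}(G)$ and $U\le G$ a compact open subgroup which is tidy above for $\alpha$. Then (i) the group $U_{--}\le G$ is closed if and only if $U_{--}\cap U=U_-$, and (ii) if $U_{--}$ is closed, then $U_{++}\cap U=U_+$.
   Context: $\mathrm{End}(G)$ is the semigroup of continuous homomorphisms $G\to G$; $\alpha^{-k}$ denotes preimage under $\alpha^k$. Set $U_0:=U$, $U_{n+1}:=U\cap\alpha(U_n)$ and $U_{-n}:=\bigcap_{k=0}^n\alpha^{-k}(U)$ for $n\in\mathbb{N}_0$; $U_+:=\bigcap_{n\in\mathbb{N}_0}U_n$, $U_{++}:=\bigcup_{n\in\mathbb{N}_0}\alpha^n(U_+)$, $U_-:=\bigcap_{n\in\mathbb{N}_0}U_{-n}$, $U_{--}:=\bigcup_{n\in\mathbb{N}_0}\alpha^{-n}(U_-)$. $U$ is tidy above for $\alpha$ if $U=U_+U_-$. *)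

theory Defs
  imports "HOL-Analysis.Analysis" "HOL-Algebra.Coset"
begin

locale topological_group = group G for G (structure) +
  fixes T :: "'a topology"
  assumes topspace_eq: "topspace T = carrier G"
    and continuous_mult: "continuous_map (prod_topology T T) T (\<lambda>(x, y). x \<otimes> y)"
    and continuous_inv: "continuous_map T T (\<lambda>x. inv x)"

text \<open>A totally disconnected topological group is automatically Hausdorff: the connected component
  of the neutral element, being closed, makes the group T1. No separation axiom is therefore
  imposed in \<^locale>\<open>topological_group\<close>.\<close>

definition totally_disconnected_space :: "'a topology \<Rightarrow> bool" where
  "totally_disconnected_space X \<longleftrightarrow>
     (\<forall>x \<in> topspace X. connected_component_of_set X x = {x})"

definition continuous_End :: "('a, 'b) monoid_scheme \<Rightarrow> 'a topology \<Rightarrow> ('a \<Rightarrow> 'a) set" where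
  "continuous_End G T = {\<alpha> \<in> hom G G. continuous_map T T \<alpha>}"

text \<open>Endomorphisms are unconstrained outside the carrier, so preimages are taken inside
  \<^term>\<open>carrier G\<close>.\<close>

definition iter_preimage ::
    "('a, 'b) monoid_scheme \<Rightarrow> ('a \<Rightarrow> 'a) \<Rightarrow> nat \<Rightarrow> 'a set \<Rightarrow> 'a set" where
  "iter_preimage G \<alpha> k A = {x \<in> carrier G. (\<alpha> ^^ k) x \<in> A}"

text \<open>In the notation of the literature on endomorphisms of totally disconnected locally compact
  groups, \<open>U_pos \<alpha> U n\<close> is $U_n$, \<open>U_neg G \<alpha> U n\<close> is $U_{-n}$, and the four definitions
  after them are $U_+$, $U_{++}$, $U_-$ and $U_{--}$.\<close>

primrec U_pos :: "('a \<Rightarrow> 'a) \<Rightarrow> 'a set \<Rightarrow> nat \<Rightarrow> 'a set" where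
  "U_pos \<alpha> U 0 = U"
| "U_pos \<alpha> U (Suc n) = U \<inter> \<alpha> ` U_pos \<alpha> U n"

definition U_neg ::
    "('a, 'b) monoid_scheme \<Rightarrow> ('a \<Rightarrow> 'a) \<Rightarrow> 'a set \<Rightarrow> nat \<Rightarrow> 'a set" where
  "U_neg G \<alpha> U n = (\<Inter>k\<in>{0..n}. iter_preimage G \<alpha> k U)"

definition U_plus :: "('a \<Rightarrow> 'a) \<Rightarrow> 'a set \<Rightarrow> 'a set" where
  "U_plus \<alpha> U = (\<Inter>n. U_pos \<alpha> U n)"

definition U_plusplus :: "('a \<Rightarrow> 'a) \<Rightarrow> 'a set \<Rightarrow> 'a set" where
  "U_plusplus \<alpha> U = (\<Union>n. (\<alpha> ^^ n) ` U_plus \<alpha> U)"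

definition U_minus :: "('a, 'b) monoid_scheme \<Rightarrow> ('a \<Rightarrow> 'a) \<Rightarrow> 'a set \<Rightarrow> 'a set" where
  "U_minus G \<alpha> U = (\<Inter>n. U_neg G \<alpha> U n)"

definition U_minusminus :: "('a, 'b) monoid_scheme \<Rightarrow> ('a \<Rightarrow> 'a) \<Rightarrow> 'a set \<Rightarrow> 'a set" where
  "U_minusminus G \<alpha> U = (\<Union>n. iter_preimage G \<alpha> n (U_minus G \<alpha> U))"

definition tidy_above :: "('a, 'b) monoid_scheme \<Rightarrow> ('a \<Rightarrow> 'a) \<Rightarrow> 'a set \<Rightarrow> bool" where
  "tidy_above G \<alpha> U \<longleftrightarrow> U = U_plus \<alpha> U <#>\<^bsub>G\<^esub> U_minus G \<alpha> U"

end

theory Submission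
  imports Defs
begin

text \<open>
  Write \<open>V = U_{--}\<close>. It is a subgroup because it is the increasing union of the subgroups
  \<open>\<alpha>\<^sup>-\<^sup>n(U_-)\<close>, each of which is closed.

  If \<open>V \<inter> U = U_-\<close>, then \<open>V\<close> meets a neighbourhood of the identity in a closed set, and a
  subgroup with this property is closed (\<open>closedin_subgroup_if_closedin_Int_open\<close>).

  Conversely, let \<open>V\<close> be closed. The compact group \<open>V \<inter> U\<close> is the increasing union of the closed
  subgroups \<open>\<alpha>\<^sup>-\<^sup>n(U_-) \<inter> U\<close>. By the Baire category theorem one of them has interior, and finitely
  many translates of it cover, so the chain is stationary (\<open>compact_subgroup_chain_stationary\<close>):
  a single \<open>N\<close> satisfies \<open>\<alpha>\<^sup>N(V \<inter> U) \<subseteq> U_-\<close>. An element \<open>x\<close> of \<open>V \<inter> U_+\<close> has the form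
  \<open>\<alpha>\<^sup>N(y)\<close> with \<open>y \<in> U_+\<close>, since compactness gives \<open>U_+ \<subseteq> \<alpha>(U_+)\<close>; this \<open>y\<close> lies in \<open>V \<inter> U\<close>
  again, so \<open>x \<in> U_-\<close>. Thus \<open>V \<inter> U_+ \<subseteq> U_-\<close>, and the factorization \<open>U = U_+U_-\<close> extends this
  to \<open>V \<inter> U \<subseteq> U_-\<close>.

  For the last claim, let \<open>\<alpha>\<^sup>n(y) \<in> U\<close> with \<open>y \<in> U_+\<close>, and factor it as \<open>v \<alpha>\<^sup>n(z)\<close> with
  \<open>v \<in> U_-\<close> and \<open>z \<in> U_+\<close>. Then \<open>w = y z\<^sup>-\<^sup>1 \<in> U_+\<close> is mapped by \<open>\<alpha>\<^sup>n\<close> to \<open>v \<in> U_-\<close>, so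
  \<open>w \<in> V \<inter> U = U_-\<close>. The forward orbit of an element of \<open>U_+ \<inter> U_-\<close> stays in \<open>U_+\<close>, as
  \<open>\<alpha>(U_+) \<inter> U = U_+\<close>. Therefore \<open>v \<in> U_+\<close>, and so \<open>\<alpha>\<^sup>n(y) \<in> U_+\<close>.
\<close>

section \<open>Subgroups of topological groups\<close>

context topological_group
begin

lemma continuous_map_mult:
  assumes "continuous_map X T f" and "continuous_map X T g"
  shows "continuous_map X T (\<lambda>x. f x \<otimes> g x)"
  using continuous_map_compose[OF continuous_map_pairedI[OF assms] continuous_mult]
  by (simp add: o_def)

lemma continuous_map_inv:
  assumes "continuous_map X T f"
  shows "continuous_map X T (\<lambda>x. inv (f x))"
  using continuous_map_compose[OF assms continuous_inv] by (simp add: o_def)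

lemma openin_left_translate_preimage:
  assumes "a \<in> carrier G" and "openin T W"
  shows "openin T {x \<in> carrier G. a \<otimes> x \<in> W}"
proof -
  have "continuous_map T T (\<lambda>x. a \<otimes> x)"
    using assms(1) by (intro continuous_map_mult) (simp_all add: topspace_eq)
  then show ?thesis
    using openin_continuous_map_preimage assms(2) unfolding topspace_eq[symmetric] by blast
qed

text \<open>Connected components are closed, so points are closed; the diagonal is the preimage of the
  identity under \<open>(x, y) \<mapsto> x y\<^sup>-\<^sup>1\<close>.\<close>

lemma Hausdorff_if_totally_disconnected:
  assumes "totally_disconnected_space T"
  shows "Hausdorff_space T"
proof -
  have "closedin T {\<one>}"
    using assms closedin_connected_component_of[of T "\<one>"]
    by (simp add: totally_disconnected_space_def topspace_eq)
  moreover have "continuous_map (prod_topology T T) T (\<lambda>p. fst p \<otimes> inv (snd p))"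
    by (intro continuous_map_mult continuous_map_inv continuous_map_fst continuous_map_snd)
  ultimately have "closedin (prod_topology T T)
      {p \<in> topspace (prod_topology T T). fst p \<otimes> inv (snd p) \<in> {\<one>}}"
    by (rule closedin_continuous_map_preimage[rotated])
  moreover have "{p \<in> topspace (prod_topology T T). fst p \<otimes> inv (snd p) \<in> {\<one>}}
      = (\<lambda>x. (x, x)) ` topspace T"
    by (auto simp: topspace_eq inv_solve_right')
  ultimately show ?thesis
    by (simp add: Hausdorff_space_closedin_diagonal)
qed

text \<open>A point of the closure can be translated by an element of \<open>H\<close> into the neighbourhood \<open>U\<close> of
  the identity, where \<open>H\<close> is closed.\<close>

lemma closedin_subgroup_if_closedin_Int_open:
  assumes H: "subgroup H G" and U: "openin T U" "\<one> \<in> U" and HU: "closedin T (H \<inter> U)"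
  shows "closedin T H"
proof -
  have Hsub: "H \<subseteq> carrier G"
    using H by (rule subgroup.subset)
  have "x \<in> H" if x: "x \<in> T closure_of H" for x
  proof -
    have xc: "x \<in> carrier G"
      using x by (simp add: in_closure_of topspace_eq)
    have "continuous_map T T (\<lambda>y. inv y \<otimes> x)"
      using xc by (intro continuous_map_mult continuous_map_inv) (simp_all add: topspace_eq)
    then have "openin T {y \<in> topspace T. inv y \<otimes> x \<in> U}"
      using U(1) by (rule openin_continuous_map_preimage)
    moreover have "x \<in> {y \<in> topspace T. inv y \<otimes> x \<in> U}"
      using xc U(2) by (simp add: topspace_eq)
    ultimately obtain h where "h \<in> H" "h \<in> {y \<in> topspace T. inv y \<otimes> x \<in> U}"
      using x unfolding in_closure_of by meson
    then have h: "h \<in> H" "inv h \<otimes> x \<in> U"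
      by simp_all
    have hc: "h \<in> carrier G" "inv h \<in> carrier G"
      using h Hsub by auto
    have "inv h \<otimes> x \<in> T closure_of (H \<inter> U)"
      unfolding in_closure_of
    proof (intro conjI allI impI)
      show "inv h \<otimes> x \<in> topspace T"
        using hc xc by (simp add: topspace_eq)
      fix W assume W: "inv h \<otimes> x \<in> W \<and> openin T W"
      have "openin T {y \<in> carrier G. inv h \<otimes> y \<in> W \<inter> U}"
        using hc W U by (intro openin_left_translate_preimage) auto
      moreover have "x \<in> {y \<in> carrier G. inv h \<otimes> y \<in> W \<inter> U}"
        using xc W h by simp
      ultimately obtain y where "y \<in> H" "y \<in> {y \<in> carrier G. inv h \<otimes> y \<in> W \<inter> U}"
        using x unfolding in_closure_of by meson
      then have "inv h \<otimes> y \<in> W \<inter> U"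
        by simp
      moreover have "inv h \<otimes> y \<in> H"
        using H h \<open>y \<in> H\<close> by (simp add: subgroup.m_closed subgroup.m_inv_closed)
      ultimately show "\<exists>y. y \<in> H \<inter> U \<and> y \<in> W"
        by (intro exI[of _ "inv h \<otimes> y"]) simp
    qed
    then have "inv h \<otimes> x \<in> H"
      using HU by (simp add: closure_of_closedin)
    then have "h \<otimes> (inv h \<otimes> x) \<in> H"
      using H h by (simp add: subgroup.m_closed)
    then show "x \<in> H"
      using hc xc by (simp add: m_assoc[symmetric])
  qed
  moreover have "H \<subseteq> T closure_of H"
    using Hsub by (intro closure_of_subset) (simp add: topspace_eq)
  ultimately show ?thesis
    using closure_of_eq[of T H] by blast
qed

text \<open>By Baire some \<open>H n\<close> contains a nonempty relatively open subset of \<open>K\<close>. Finitely many left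
  translates of that subset cover \<open>K\<close>, and the translating elements all lie in some later \<open>H N\<close>.\<close>

lemma compact_subgroup_chain_stationary:
  assumes Hd: "Hausdorff_space T" and K: "subgroup K G" "compactin T K"
    and H: "\<And>n. subgroup (H n) G" "\<And>n. closedin T (H n)" "incseq H" and KH: "K = (\<Union>n. H n)"
  shows "\<exists>N. K = H N"
proof -
  have Ksub: "K \<subseteq> carrier G"
    using K(1) by (rule subgroup.subset)
  let ?X = "subtopology T K"
  have top: "topspace ?X = K"
    using Ksub by (auto simp: topspace_eq)
  have comp: "compact_space ?X"
    using K(2) by (rule compact_space_subtopology)
  have "regular_space ?X"
    using comp Hd by (simp add: compact_Hausdorff_imp_regular_space Hausdorff_space_subtopology)
  then have "\<exists>n. ?X interior_of (H n) \<noteq> {}"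
  proof (rule contrapos_pp)
    assume "\<nexists>n. ?X interior_of (H n) \<noteq> {}"
    moreover have "closedin ?X (H n)" for n
      using H(2) KH by (intro closedin_subset_topspace) auto
    ultimately have "?X interior_of \<Union>(range H) = {}" if "regular_space ?X"
      using that comp by (intro Baire_category_alt) (auto simp: compact_imp_locally_compact_space)
    moreover have "?X interior_of \<Union>(range H) = K"
      using interior_of_topspace[of ?X] unfolding top using KH by simp
    moreover have "K \<noteq> {}"
      using K(1) subgroup.one_closed by blast
    ultimately show "\<not> regular_space ?X"
      by blast
  qed
  then obtain n W w where W: "openin T W" "W \<inter> K \<subseteq> H n" "w \<in> W" "w \<in> K"
    unfolding interior_of_def openin_subtopology by blast
  have wc: "w \<in> carrier G"
    using W Ksub by blast
  \<comment> \<open>The set \<open>E k\<close> is the left translate of \<open>W\<close> by \<open>k w\<^sup>-\<^sup>1\<close>, a neighbourhood of \<open>k\<close>.\<close>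
  define E where "E k = {x \<in> carrier G. (w \<otimes> inv k) \<otimes> x \<in> W}" for k
  have "openin T (E k)" if "k \<in> K" for k
    unfolding E_def using that Ksub wc W by (intro openin_left_translate_preimage) auto
  moreover have "k \<in> E k" if "k \<in> K" for k
    using that Ksub wc W by (auto simp: E_def m_assoc)
  ultimately have "\<And>W. W \<in> E ` K \<Longrightarrow> openin T W" "K \<subseteq> \<Union>(E ` K)"
    by auto
  then obtain \<F> where "finite \<F>" "\<F> \<subseteq> E ` K" "K \<subseteq> \<Union>\<F>"
    using compactinD[OF K(2)] by meson
  then obtain F where F: "finite F" "F \<subseteq> K" "K \<subseteq> (\<Union>k\<in>F. E k)"
    by (metis finite_subset_image)
  have "\<exists>N. \<forall>x \<in> insert w F. x \<in> H N"
  proof -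
    have "\<forall>x \<in> insert w F. \<exists>m. x \<in> H m"
      using F W KH by blast
    then obtain m where m: "\<And>x. x \<in> insert w F \<Longrightarrow> x \<in> H (m x)"
      by metis
    have "x \<in> H (Max (m ` insert w F))" if "x \<in> insert w F" for x
    proof -
      have "m x \<le> Max (m ` insert w F)"
        using F(1) that by (intro Max_ge) auto
      then show ?thesis
        using m[OF that] incseqD[OF H(3)] by blast
    qed
    then show ?thesis
      by blast
  qed
  then obtain N0 where N0: "\<And>x. x \<in> insert w F \<Longrightarrow> x \<in> H N0"
    by blast
  define N where "N = max n N0"
  have N: "x \<in> H N" if "x \<in> insert w F" for x
    using N0[OF that] incseqD[OF H(3), of N0 N] by (auto simp: N_def)
  have "x \<in> H N" if x: "x \<in> K" for x
  proof -
    obtain k where k: "k \<in> F" "(w \<otimes> inv k) \<otimes> x \<in> W"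
      using x F(3) by (auto simp: E_def)
    have c: "k \<in> carrier G" "x \<in> carrier G" "k \<in> K"
      using k F x Ksub by auto
    have "(w \<otimes> inv k) \<otimes> x \<in> K"
      using K(1) W c x by (simp add: subgroup.m_closed subgroup.m_inv_closed)
    then have "(w \<otimes> inv k) \<otimes> x \<in> H n"
      using k W by blast
    then have *: "(w \<otimes> inv k) \<otimes> x \<in> H N"
      using incseqD[OF H(3), of n N] by (auto simp: N_def)
    have "w \<in> H N" "k \<in> H N"
      using N k by auto
    then have "(k \<otimes> inv w) \<otimes> ((w \<otimes> inv k) \<otimes> x) \<in> H N"
      using * H(1)[of N] by (simp add: subgroup.m_closed subgroup.m_inv_closed)
    moreover have "k \<otimes> inv w = inv (w \<otimes> inv k)"
      using c wc by (simp add: inv_mult_group)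
    then have "(k \<otimes> inv w) \<otimes> ((w \<otimes> inv k) \<otimes> x) = x"
      using c wc by (simp add: inv_solve_left')
    ultimately show ?thesis
      by simp
  qed
  then show ?thesis
    using KH by blast
qed

end

section \<open>The subgroups attached to an endomorphism and a compact open subgroup\<close>

locale endo_compact_open_subgroup = topological_group G T for G (structure) and T +
  fixes \<alpha> :: "'a \<Rightarrow> 'a" and U :: "'a set"
  assumes Hausdorff: "Hausdorff_space T"
    and endo: "\<alpha> \<in> continuous_End G T"
    and subgroup_U: "subgroup U G"
    and compact_U: "compactin T U"
    and open_U: "openin T U"
begin

lemma U_subset: "U \<subseteq> carrier G"
  using subgroup_U by (rule subgroup.subset)

lemma closed_U: "closedin T U"
  using Hausdorff compact_U by (rule compactin_imp_closedin)

lemma continuous_endo: "continuous_map T T \<alpha>"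
  using endo by (simp add: continuous_End_def)

lemma group_hom_funpow: "group_hom G G (\<alpha> ^^ n)"
proof -
  have "\<alpha> ^^ n \<in> hom G G"
  proof (induction n)
    case 0
    then show ?case by (simp add: hom_def)
  next
    case (Suc n)
    then show ?case
      using endo Group.hom_compose[of "\<alpha> ^^ n" G G \<alpha> G]
      unfolding continuous_End_def funpow.simps by blast
  qed
  then show ?thesis
    by (simp add: group_hom_def group_hom_axioms_def is_group)
qed

lemma continuous_funpow: "continuous_map T T (\<alpha> ^^ n)"
proof (induction n)
  case 0
  then show ?case by (simp add: id_def[symmetric])
next
  case (Suc n)
  then show ?case
    unfolding funpow.simps by (intro continuous_map_compose[OF _ continuous_endo])
qed

lemma funpow_closed: "x \<in> carrier G \<Longrightarrow> (\<alpha> ^^ n) x \<in> carrier G"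
  using group_hom.hom_closed[OF group_hom_funpow] .

lemma subgroup_iter_preimage:
  assumes "subgroup A G"
  shows "subgroup (iter_preimage G \<alpha> n A) G"
proof -
  interpret h: group_hom G G "\<alpha> ^^ n"
    by (rule group_hom_funpow)
  show ?thesis
    using assms
    by unfold_locales (auto simp: iter_preimage_def subgroup.m_closed subgroup.one_closed
        subgroup.m_inv_closed)
qed

lemma closedin_iter_preimage:
  assumes "closedin T A"
  shows "closedin T (iter_preimage G \<alpha> n A)"
  using closedin_continuous_map_preimage[OF continuous_funpow assms]
  by (simp add: iter_preimage_def topspace_eq)

subsection \<open>The groups \<open>U_-\<close> and \<open>U_{--}\<close>\<close>

lemma U_minus_eq_Inter: "U_minus G \<alpha> U = (\<Inter>k. iter_preimage G \<alpha> k U)"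
  unfolding U_minus_def U_neg_def by force

lemma mem_U_minus_iff: "x \<in> U_minus G \<alpha> U \<longleftrightarrow> x \<in> carrier G \<and> (\<forall>k. (\<alpha> ^^ k) x \<in> U)"
  by (auto simp: U_minus_eq_Inter iter_preimage_def)

lemma subgroup_U_minus: "subgroup (U_minus G \<alpha> U) G"
  unfolding U_minus_eq_Inter
  by (intro subgroups_Inter) (auto intro: subgroup_iter_preimage subgroup_U)

lemma closedin_U_minus: "closedin T (U_minus G \<alpha> U)"
  unfolding U_minus_eq_Inter
  by (intro closedin_INT closedin_iter_preimage closed_U) simp

lemma U_minus_subset: "U_minus G \<alpha> U \<subseteq> U"
proof
  fix x assume "x \<in> U_minus G \<alpha> U"
  then have "(\<alpha> ^^ 0) x \<in> U"
    unfolding mem_U_minus_iff by blast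
  then show "x \<in> U"
    by simp
qed

lemma U_minus_funpow: "x \<in> U_minus G \<alpha> U \<Longrightarrow> (\<alpha> ^^ n) x \<in> U_minus G \<alpha> U"
proof -
  assume x: "x \<in> U_minus G \<alpha> U"
  have "(\<alpha> ^^ k) ((\<alpha> ^^ n) x) = (\<alpha> ^^ (k + n)) x" for k
    by (simp add: funpow_add)
  then show ?thesis
    using x by (simp add: mem_U_minus_iff funpow_closed)
qed

lemma incseq_iter_preimage_U_minus: "incseq (\<lambda>n. iter_preimage G \<alpha> n (U_minus G \<alpha> U))"
  by (rule incseq_SucI) (use U_minus_funpow[of _ 1] in \<open>auto simp: iter_preimage_def\<close>)

lemma mem_U_minusminus_iff:
  "x \<in> U_minusminus G \<alpha> U \<longleftrightarrow> x \<in> carrier G \<and> (\<exists>n. (\<alpha> ^^ n) x \<in> U_minus G \<alpha> U)"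
  by (auto simp: U_minusminus_def iter_preimage_def)

lemma U_minus_subset_U_minusminus: "U_minus G \<alpha> U \<subseteq> U_minusminus G \<alpha> U"
proof
  fix x assume "x \<in> U_minus G \<alpha> U"
  then have "x \<in> carrier G" "(\<alpha> ^^ 0) x \<in> U_minus G \<alpha> U"
    by (simp_all add: mem_U_minus_iff)
  then show "x \<in> U_minusminus G \<alpha> U"
    unfolding mem_U_minusminus_iff by blast
qed

lemma subgroup_U_minusminus: "subgroup (U_minusminus G \<alpha> U) G"
proof (rule subgroupI)
  let ?A = "\<lambda>n. iter_preimage G \<alpha> n (U_minus G \<alpha> U)"
  have A: "subgroup (?A n) G" for n
    by (intro subgroup_iter_preimage subgroup_U_minus)
  show "U_minusminus G \<alpha> U \<subseteq> carrier G"
    by (auto simp: mem_U_minusminus_iff)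
  show "U_minusminus G \<alpha> U \<noteq> {}"
    using subgroup.one_closed[OF A] by (auto simp: U_minusminus_def)
  show "inv a \<in> U_minusminus G \<alpha> U" if "a \<in> U_minusminus G \<alpha> U" for a
    using that subgroup.m_inv_closed[OF A] by (auto simp: U_minusminus_def)
  show "a \<otimes> b \<in> U_minusminus G \<alpha> U"
    if ab: "a \<in> U_minusminus G \<alpha> U" "b \<in> U_minusminus G \<alpha> U" for a b
  proof -
    obtain m n where "a \<in> ?A m" "b \<in> ?A n"
      using ab by (auto simp: U_minusminus_def)
    then have "a \<in> ?A (max m n)" "b \<in> ?A (max m n)"
      using incseq_iter_preimage_U_minus
      by (meson incseq_def max.cobounded1 max.cobounded2 subsetD)+
    then have "a \<otimes> b \<in> ?A (max m n)"
      by (rule subgroup.m_closed[OF A])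
    then show ?thesis
      unfolding U_minusminus_def by blast
  qed
qed

subsection \<open>The group \<open>U_+\<close>\<close>

lemma subgroup_U_pos: "subgroup (U_pos \<alpha> U n) G"
proof (induction n)
  case (Suc n)
  have "subgroup (\<alpha> ` U_pos \<alpha> U n) G"
    using group_hom.subgroup_img_is_subgroup[OF group_hom_funpow[of 1] Suc] by simp
  then show ?case
    using subgroup_U subgroups_Inter_pair by simp
qed (simp add: subgroup_U)

lemma compactin_U_pos: "compactin T (U_pos \<alpha> U n)"
proof (induction n)
  case (Suc n)
  have "compactin T (\<alpha> ` U_pos \<alpha> U n)"
    using Suc continuous_endo by (rule image_compactin)
  then show ?case
    using closed_Int_compactin[OF closed_U] by simp
qed (simp add: compact_U)

lemma decseq_U_pos: "decseq (U_pos \<alpha> U)"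
proof (rule decseq_SucI)
  show "U_pos \<alpha> U (Suc n) \<subseteq> U_pos \<alpha> U n" for n
    by (induction n) auto
qed

lemma subgroup_U_plus: "subgroup (U_plus \<alpha> U) G"
  unfolding U_plus_def by (intro subgroups_Inter) (auto simp: subgroup_U_pos)

lemma U_plus_subset: "U_plus \<alpha> U \<subseteq> U"
  unfolding U_plus_def using INT_lower[of 0 UNIV "U_pos \<alpha> U"] by simp

lemma image_U_plus_Int_subset: "\<alpha> ` U_plus \<alpha> U \<inter> U \<subseteq> U_plus \<alpha> U"
proof
  fix x assume x: "x \<in> \<alpha> ` U_plus \<alpha> U \<inter> U"
  have "x \<in> U_pos \<alpha> U n" for n
    using x by (cases n) (auto simp: U_plus_def)
  then show "x \<in> U_plus \<alpha> U"
    by (simp add: U_plus_def)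
qed

text \<open>The preimages of a point of \<open>U_+\<close> in the groups \<open>U_n\<close> form a decreasing sequence of nonempty
  compact sets.\<close>

lemma U_plus_subset_image: "U_plus \<alpha> U \<subseteq> \<alpha> ` U_plus \<alpha> U"
proof
  fix x assume x: "x \<in> U_plus \<alpha> U"
  define C where "C n = {y \<in> topspace T. \<alpha> y \<in> {x}} \<inter> U_pos \<alpha> U n" for n
  have "x \<in> topspace T"
    using subsetD[OF U_subset subsetD[OF U_plus_subset x]] by (simp add: topspace_eq)
  then have "closedin T {x}"
    by (intro compactin_imp_closedin[OF Hausdorff]) simp
  then have "closedin T (C n)" for n
    unfolding C_def
    using compactin_imp_closedin[OF Hausdorff compactin_U_pos]
    by (intro closedin_Int closedin_continuous_map_preimage[OF continuous_endo])
  moreover have sub: "U_pos \<alpha> U n \<subseteq> U" for n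
    by (cases n) auto
  ultimately have "closedin (subtopology T U) (C n)" for n
    by (intro closedin_subset_topspace) (auto simp: C_def)
  moreover have "C n \<noteq> {}" for n
  proof -
    have "x \<in> U_pos \<alpha> U (Suc n)"
      using x unfolding U_plus_def by blast
    then obtain y where "y \<in> U_pos \<alpha> U n" "\<alpha> y = x"
      by auto
    then show ?thesis
      using sub U_subset by (auto simp: C_def topspace_eq)
  qed
  moreover have "decseq C"
    using decseq_U_pos unfolding decseq_def C_def by blast
  ultimately have "(\<Inter>n. C n) \<noteq> {}"
    using compact_space_subtopology[OF compact_U] by (intro compact_space_imp_nest)
  then show "x \<in> \<alpha> ` U_plus \<alpha> U"
    by (auto simp: C_def U_plus_def)
qed

lemma U_plus_subset_funpow_image: "U_plus \<alpha> U \<subseteq> (\<alpha> ^^ n) ` U_plus \<alpha> U"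
proof (induction n)
  case (Suc n)
  have "U_plus \<alpha> U \<subseteq> \<alpha> ` U_plus \<alpha> U"
    by (rule U_plus_subset_image)
  also have "\<dots> \<subseteq> \<alpha> ` (\<alpha> ^^ n) ` U_plus \<alpha> U"
    using Suc by (rule image_mono)
  finally show ?case
    by (simp add: image_comp)
qed simp

lemma funpow_U_plus_Int_U_minus:
  assumes "x \<in> U_plus \<alpha> U" and "x \<in> U_minus G \<alpha> U"
  shows "(\<alpha> ^^ n) x \<in> U_plus \<alpha> U"
proof (induction n)
  case (Suc n)
  have "(\<alpha> ^^ Suc n) x \<in> U"
    using assms(2) unfolding mem_U_minus_iff by blast
  then show ?case
    using Suc image_U_plus_Int_subset by auto
qed (simp add: assms)

section \<open>Closedness of \<open>U_{--}\<close>\<close>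

lemma closedin_U_minusminus_if:
  assumes "U_minusminus G \<alpha> U \<inter> U = U_minus G \<alpha> U"
  shows "closedin T (U_minusminus G \<alpha> U)"
  using subgroup_U_minusminus open_U
  by (rule closedin_subgroup_if_closedin_Int_open)
     (simp_all add: assms closedin_U_minus subgroup.one_closed[OF subgroup_U])

text \<open>This is where closedness of \<open>U_{--}\<close> enters: it makes \<open>U_{--} \<inter> U\<close> compact, so the chain
  \<open>\<alpha>\<^sup>-\<^sup>n(U_-) \<inter> U\<close> exhausting it must become stationary.\<close>

lemma U_minusminus_Int_U_uniform:
  assumes "closedin T (U_minusminus G \<alpha> U)"
  shows "\<exists>N. \<forall>x \<in> U_minusminus G \<alpha> U \<inter> U. (\<alpha> ^^ N) x \<in> U_minus G \<alpha> U"
proof -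
  let ?H = "\<lambda>n. iter_preimage G \<alpha> n (U_minus G \<alpha> U) \<inter> U"
  have "\<exists>N. U_minusminus G \<alpha> U \<inter> U = ?H N"
  proof (rule compact_subgroup_chain_stationary[OF Hausdorff])
    show "subgroup (U_minusminus G \<alpha> U \<inter> U) G"
      by (intro subgroups_Inter_pair subgroup_U_minusminus subgroup_U)
    show "compactin T (U_minusminus G \<alpha> U \<inter> U)"
      using assms compact_U by (rule closed_Int_compactin)
    show "subgroup (?H n) G" for n
      by (intro subgroups_Inter_pair subgroup_iter_preimage subgroup_U_minus subgroup_U)
    show "closedin T (?H n)" for n
      by (intro closedin_Int closedin_iter_preimage closedin_U_minus closed_U)
    show "incseq ?H"
      using incseq_iter_preimage_U_minus unfolding incseq_def by blast
    show "U_minusminus G \<alpha> U \<inter> U = (\<Union>n. ?H n)"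
      by (auto simp: U_minusminus_def)
  qed
  then show ?thesis
    by (auto simp: iter_preimage_def)
qed

text \<open>A point of \<open>U_+\<close> can be pulled back along \<open>\<alpha>\<close> inside \<open>U_+\<close> by any number of steps, in
  particular by the uniform number after which all of \<open>U_{--} \<inter> U\<close> has entered \<open>U_-\<close>.\<close>

lemma U_plus_Int_U_minusminus_subset:
  assumes "closedin T (U_minusminus G \<alpha> U)"
  shows "U_plus \<alpha> U \<inter> U_minusminus G \<alpha> U \<subseteq> U_minus G \<alpha> U"
proof
  fix x assume x: "x \<in> U_plus \<alpha> U \<inter> U_minusminus G \<alpha> U"
  obtain N where N: "\<And>y. y \<in> U_minusminus G \<alpha> U \<inter> U \<Longrightarrow> (\<alpha> ^^ N) y \<in> U_minus G \<alpha> U"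
    using U_minusminus_Int_U_uniform[OF assms] by blast
  obtain y where y: "y \<in> U_plus \<alpha> U" "(\<alpha> ^^ N) y = x"
    using x U_plus_subset_funpow_image[of N] by auto
  obtain n where "(\<alpha> ^^ n) x \<in> U_minus G \<alpha> U"
    using x by (auto simp: mem_U_minusminus_iff)
  then have "(\<alpha> ^^ (n + N)) y \<in> U_minus G \<alpha> U"
    using y by (simp add: funpow_add)
  moreover have "y \<in> U"
    using y(1) U_plus_subset by (rule subsetD[rotated])
  ultimately have "y \<in> U_minusminus G \<alpha> U \<inter> U"
    using U_subset mem_U_minusminus_iff by (intro IntI) auto
  then show "x \<in> U_minus G \<alpha> U"
    using N y(2) by metis
qed

text \<open>By tidiness an element of \<open>U_{--} \<inter> U\<close> is congruent modulo \<open>U_-\<close> to one of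
  \<open>U_+\<close>, which still lies in \<open>U_{--}\<close> because \<open>U_- \<subseteq> U_{--}\<close>.\<close>

lemma U_minusminus_Int_U:
  assumes tidy: "tidy_above G \<alpha> U" and closed: "closedin T (U_minusminus G \<alpha> U)"
  shows "U_minusminus G \<alpha> U \<inter> U = U_minus G \<alpha> U"
proof
  show "U_minus G \<alpha> U \<subseteq> U_minusminus G \<alpha> U \<inter> U"
    using U_minus_subset U_minus_subset_U_minusminus by blast
  show "U_minusminus G \<alpha> U \<inter> U \<subseteq> U_minus G \<alpha> U"
  proof
    fix x assume x: "x \<in> U_minusminus G \<alpha> U \<inter> U"
    then have "x \<in> U_plus \<alpha> U <#> U_minus G \<alpha> U"
      using tidy unfolding tidy_above_def by blast
    then obtain a b where ab: "a \<in> U_plus \<alpha> U" "b \<in> U_minus G \<alpha> U" "x = a \<otimes> b"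
      unfolding set_mult_def by blast
    have c: "a \<in> carrier G" "b \<in> carrier G"
      using ab U_plus_subset U_minus_subset U_subset by blast+
    have "x \<otimes> inv b \<in> U_minusminus G \<alpha> U"
      using x ab(2) U_minus_subset_U_minusminus subgroup_U_minusminus
      by (auto intro!: subgroup.m_closed subgroup.m_inv_closed)
    then have "a \<in> U_minusminus G \<alpha> U"
      using ab c by (simp add: m_assoc)
    then have "a \<in> U_minus G \<alpha> U"
      using ab U_plus_Int_U_minusminus_subset[OF closed] by blast
    then show "x \<in> U_minus G \<alpha> U"
      using ab subgroup.m_closed[OF subgroup_U_minus] by simp
  qed
qed

text \<open>Modulo an element \<open>\<alpha>\<^sup>n(z)\<close> of \<open>U_+\<close>, a point \<open>\<alpha>\<^sup>n(y) \<in> U\<close> lies in \<open>U_-\<close>; then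
  \<open>y z\<^sup>-\<^sup>1\<close> lies in \<open>U_{--} \<inter> U\<close>.\<close>

lemma U_plusplus_Int_U:
  assumes tidy: "tidy_above G \<alpha> U" and mm: "U_minusminus G \<alpha> U \<inter> U = U_minus G \<alpha> U"
  shows "U_plusplus \<alpha> U \<inter> U = U_plus \<alpha> U"
proof
  have "U_plus \<alpha> U \<subseteq> U_plusplus \<alpha> U"
    unfolding U_plusplus_def by (rule UN_upper[of 0 UNIV "\<lambda>n. (\<alpha> ^^ n) ` U_plus \<alpha> U", simplified])
  then show "U_plus \<alpha> U \<subseteq> U_plusplus \<alpha> U \<inter> U"
    using U_plus_subset by blast
  show "U_plusplus \<alpha> U \<inter> U \<subseteq> U_plus \<alpha> U"
  proof
    fix x assume x: "x \<in> U_plusplus \<alpha> U \<inter> U"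
    then obtain n y where y: "y \<in> U_plus \<alpha> U" "x = (\<alpha> ^^ n) y"
      by (auto simp: U_plusplus_def)
    have xc: "x \<in> carrier G"
      using x U_subset by blast
    \<comment> \<open>Tidiness factors \<open>U\<close> with \<open>U_+\<close> on the left; applied to the inverse of \<open>x\<close> it puts \<open>U_+\<close>
      on the right.\<close>
    have "inv x \<in> U_plus \<alpha> U <#> U_minus G \<alpha> U"
      using tidy x subgroup.m_inv_closed[OF subgroup_U] unfolding tidy_above_def by blast
    then obtain a b where ab: "a \<in> U_plus \<alpha> U" "b \<in> U_minus G \<alpha> U" "inv x = a \<otimes> b"
      unfolding set_mult_def by blast
    have c: "a \<in> carrier G" "b \<in> carrier G"
      using ab U_plus_subset U_minus_subset U_subset by blast+
    have "x = inv (a \<otimes> b)"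
      using ab(3) xc by (metis inv_inv)
    then have x_eq: "x = inv b \<otimes> inv a"
      using c by (simp add: inv_mult_group)
    have "inv a \<in> U_plus \<alpha> U"
      using ab subgroup.m_inv_closed[OF subgroup_U_plus] by simp
    then obtain z where z: "z \<in> U_plus \<alpha> U" "(\<alpha> ^^ n) z = inv a"
      using U_plus_subset_funpow_image[of n] by (metis imageE subsetD)
    define w where "w = y \<otimes> inv z"
    have yz: "y \<in> carrier G" "z \<in> carrier G"
      using y z U_plus_subset U_subset by blast+
    have wp: "w \<in> U_plus \<alpha> U"
      unfolding w_def
      using y z subgroup_U_plus by (simp add: subgroup.m_closed subgroup.m_inv_closed)
    interpret h: group_hom G G "\<alpha> ^^ n"
      by (rule group_hom_funpow)
    have "(\<alpha> ^^ n) w = x \<otimes> inv (inv a)"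
      using yz z(2) y(2) by (simp add: w_def)
    also have "\<dots> = inv b"
      using c by (simp add: x_eq m_assoc)
    finally have hw: "(\<alpha> ^^ n) w = inv b" .
    have "inv b \<in> U_minus G \<alpha> U"
      using ab subgroup.m_inv_closed[OF subgroup_U_minus] by simp
    then have "w \<in> U_minusminus G \<alpha> U"
      unfolding mem_U_minusminus_iff using hw yz by (intro conjI exI[of _ n]) (simp_all add: w_def)
    then have "w \<in> U_minusminus G \<alpha> U \<inter> U"
      using wp U_plus_subset by blast
    then have "w \<in> U_minus G \<alpha> U"
      using mm by simp
    then have "inv b \<in> U_plus \<alpha> U"
      using funpow_U_plus_Int_U_minus[OF wp] hw by metis
    then show "x \<in> U_plus \<alpha> U"
      using \<open>inv a \<in> U_plus \<alpha> U\<close> subgroup.m_closed[OF subgroup_U_plus] x_eq by simp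
  qed
qed

end

theorem lemma3p8:
  fixes G :: "('a, 'b) monoid_scheme" and T :: "'a topology"
    and \<alpha> :: "'a \<Rightarrow> 'a" and U :: "'a set"
  assumes "topological_group G T"
    and "totally_disconnected_space T" and "locally_compact_space T"
    and "\<alpha> \<in> continuous_End G T"
    and "subgroup U G" and "compactin T U" and "openin T U"
    and "tidy_above G \<alpha> U"
  shows "subgroup (U_minusminus G \<alpha> U) G \<and>
    (closedin T (U_minusminus G \<alpha> U) \<longleftrightarrow>
       U_minusminus G \<alpha> U \<inter> U = U_minus G \<alpha> U) \<and>
    (closedin T (U_minusminus G \<alpha> U) \<longrightarrow>
       U_plusplus \<alpha> U \<inter> U = U_plus \<alpha> U)"
proof -
  have "Hausdorff_space T"
    using assms(1,2) by (rule topological_group.Hausdorff_if_totally_disconnected)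
  with assms interpret endo_compact_open_subgroup G T \<alpha> U
    by (simp add: endo_compact_open_subgroup_def endo_compact_open_subgroup_axioms_def)
  have "closedin T (U_minusminus G \<alpha> U) \<longleftrightarrow> U_minusminus G \<alpha> U \<inter> U = U_minus G \<alpha> U"
    using closedin_U_minusminus_if U_minusminus_Int_U[OF assms(8)] by (rule iffI[rotated])
  then show ?thesis
    using subgroup_U_minusminus U_plusplus_Int_U[OF assms(8)] by simp
qed

end
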